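(* Let $d \geq 1$ and let $\Gamma \subset \mathbb{Z}^d \setminus \{\mathbf{0}\}$ be the rule set of a squarefree game in normal play on the board $\mathcal{B} = \mathbb{N}^d$, with set of P-positions $\mathcal{P}$. If $p \in \mathcal{B}$, then $p \in \mathcal{P}$ if and only if $p \cong \mathbf{0}$.
   Context: $\mathbb{N} = \{0,1,2,\ldots\}$. A finite subset $\Gamma \subset \mathbb{Z}^d \setminus \{\mathbf{0}\}$ is a rule set on $\mathbb{N}^d$ if: (a) there is a linear function $\ell : \mathbb{R}^d \to \mathbb{R}$ that is positive on every element of $\Gamma$ and on every nonzero vector of $\mathbb{R}_{\geq 0}^d$; and (b) (tangent cone axiom) for each $i \in \{1,\ldots,d\}$ there is some $\gamma \in \Gamma$ with $\gamma_j \leq 0$ for all $j \neq i$. The game with rule set $\Gamma$ in normal play has board $\mathcal{B} = \mathbb{N}^d$. The options of a position $p \in \mathcal{B}$ are the elements $p - \gamma$ with $\gamma \in \Gamma$ and $p - \gamma \in \mathbb{N}^d$. The board is partitioned as $\mathcal{B} = \mathcal{P} \sqcup \mathcal{N}$ (P-positions and N-positions), determined uniquely by the recursion: $p \in \mathcal{P}$ if and only if every option of $p$ lies in $\mathcal{N}$ (in particular if $p$ has no options), and $p \in \mathcal{N}$ if and only if some option of $p$ lies in $\mathcal{P}$. The game is squarefree if each $\gamma \in \Gamma$ has at most one positive entry, and that entry is at most $1$. For $p, q \in \mathcal{B}$, write $p \cong q$ if for all $r \in \mathbb{N}^d$ one has $p + r \in \mathcal{P}$ if and only if $q + r \in \mathcal{P}$.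 *)

theory Defs
  imports "HOL-Analysis.Analysis"
begin

definition board :: "(int ^ 'd) set" where
  "board = {p. \<forall>i. 0 \<le> p $ i}"

definition rule_set :: "(int ^ 'd::finite) set \<Rightarrow> bool" where
  "rule_set \<Gamma> \<longleftrightarrow>
     finite \<Gamma> \<and> 0 \<notin> \<Gamma> \<and>
     (\<exists>l :: real ^ 'd \<Rightarrow> real. linear l \<and>
        (\<forall>\<gamma>\<in>\<Gamma>. 0 < l (\<chi> i. real_of_int (\<gamma> $ i))) \<and>
        (\<forall>x. x \<noteq> 0 \<and> (\<forall>i. 0 \<le> x $ i) \<longrightarrow> 0 < l x)) \<and>
     (\<forall>i. \<exists>\<gamma>\<in>\<Gamma>. \<forall>j. j \<noteq> i \<longrightarrow> \<gamma> $ j \<le> 0)"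

definition game_opts :: "(int ^ 'd) set \<Rightarrow> int ^ 'd \<Rightarrow> (int ^ 'd) set" where
  "game_opts \<Gamma> p = {p - \<gamma> | \<gamma>. \<gamma> \<in> \<Gamma> \<and> p - \<gamma> \<in> board}"

text \<open>The recursion for P- and N-positions is taken as a least fixed point, which makes
  sense for every \<open>\<Gamma>\<close>. For a rule set, \<open>P_N_partition\<close> and \<open>P_N_unique\<close> below show that it
  is the unique partition of the board satisfying the recursion.\<close>

inductive_set P_positions :: "(int ^ 'd) set \<Rightarrow> (int ^ 'd) set"
  and N_positions :: "(int ^ 'd) set \<Rightarrow> (int ^ 'd) set"
  for \<Gamma> :: "(int ^ 'd) set" where
  P_posI: "p \<in> board \<Longrightarrow> (\<And>q. q \<in> game_opts \<Gamma> p \<Longrightarrow> q \<in> N_positions \<Gamma>) \<Longrightarrow> p \<in> P_positions \<Gamma>"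
| N_posI: "p \<in> board \<Longrightarrow> q \<in> game_opts \<Gamma> p \<Longrightarrow> q \<in> P_positions \<Gamma> \<Longrightarrow> p \<in> N_positions \<Gamma>"

definition squarefree_game :: "(int ^ 'd::finite) set \<Rightarrow> bool" where
  "squarefree_game \<Gamma> \<longleftrightarrow>
     (\<forall>\<gamma>\<in>\<Gamma>. card {i. 0 < \<gamma> $ i} \<le> 1 \<and> (\<forall>i. 0 < \<gamma> $ i \<longrightarrow> \<gamma> $ i \<le> 1))"

definition indist :: "(int ^ 'd) set \<Rightarrow> int ^ 'd \<Rightarrow> int ^ 'd \<Rightarrow> bool" where
  "indist \<Gamma> p q \<longleftrightarrow> (\<forall>r\<in>board. p + r \<in> P_positions \<Gamma> \<longleftrightarrow> q + r \<in> P_positions \<Gamma>)"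

lemma game_opts_board: "q \<in> game_opts \<Gamma> p \<Longrightarrow> q \<in> board"
  by (auto simp: game_opts_def)

lemma rule_set_measure:
  fixes \<Gamma> :: "(int ^ 'd::finite) set"
  assumes "rule_set \<Gamma>"
  shows "\<exists>m :: int ^ 'd \<Rightarrow> nat. \<forall>p\<in>board. \<forall>q\<in>game_opts \<Gamma> p. m q < m p"
proof -
  define R :: "int ^ 'd \<Rightarrow> real ^ 'd" where "R p = (\<chi> i. real_of_int (p $ i))" for p
  have fin: "finite \<Gamma>" using assms by (simp add: rule_set_def)
  from assms have "\<exists>l :: real ^ 'd \<Rightarrow> real. linear l \<and> (\<forall>\<gamma>\<in>\<Gamma>. 0 < l (R \<gamma>)) \<and> (\<forall>x. x \<noteq> 0 \<and> (\<forall>i. 0 \<le> x $ i) \<longrightarrow> 0 < l x)"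
    unfolding rule_set_def R_def by (elim conjE)
  then obtain l :: "real ^ 'd \<Rightarrow> real" where lin: "linear l"
    and pos: "\<And>\<gamma>. \<gamma> \<in> \<Gamma> \<Longrightarrow> 0 < l (R \<gamma>)"
    and nn: "\<And>x. x \<noteq> 0 \<Longrightarrow> (\<forall>i. 0 \<le> x $ i) \<Longrightarrow> 0 < l x"
    by auto
  have nonneg: "0 \<le> l (R p)" if "p \<in> board" for p
  proof (cases "R p = 0")
    case True then show ?thesis using linear_0[OF lin] by simp
  next
    case False
    then show ?thesis using nn[OF False] that by (simp add: R_def board_def less_imp_le)
  qed
  define e where "e = Min (insert 1 ((\<lambda>\<gamma>. l (R \<gamma>)) ` \<Gamma>))"
  have epos: "0 < e" unfolding e_def using fin pos by (subst Min_gr_iff) auto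
  have e_le: "e \<le> l (R \<gamma>)" if "\<gamma> \<in> \<Gamma>" for \<gamma>
    unfolding e_def using fin that by (intro Min_le) auto
  show ?thesis
  proof (intro exI[of _ "\<lambda>p. nat \<lfloor>l (R p) / e\<rfloor>"] ballI)
    fix p q assume p: "p \<in> board" and "q \<in> game_opts \<Gamma> p"
    then obtain \<gamma> where g: "\<gamma> \<in> \<Gamma>" "q = p - \<gamma>" and q: "q \<in> board"
      by (auto simp: game_opts_def)
    have "R q = R p - R \<gamma>" using g by (simp add: R_def vec_eq_iff)
    then have "l (R q) = l (R p) - l (R \<gamma>)" using lin by (simp add: linear_diff)
    then have "l (R q) + e \<le> l (R p)" using e_le[OF g(1)] by simp
    then have "(l (R q) + e) / e \<le> l (R p) / e" using epos by (simp add: divide_right_mono)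
    then have "l (R q) / e + 1 \<le> l (R p) / e" using epos by (simp add: add_divide_distrib)
    moreover have "0 \<le> l (R q) / e" using nonneg[OF q] epos by simp
    ultimately show "nat \<lfloor>l (R q) / e\<rfloor> < nat \<lfloor>l (R p) / e\<rfloor>" by linarith
  qed
qed

lemma P_pos_iff:
  "p \<in> P_positions \<Gamma> \<longleftrightarrow> p \<in> board \<and> game_opts \<Gamma> p \<subseteq> N_positions \<Gamma>"
  by (rule P_positions.simps[of p \<Gamma>, THEN trans]) (simp add: subset_iff)

lemma N_pos_iff:
  "p \<in> N_positions \<Gamma> \<longleftrightarrow> p \<in> board \<and> game_opts \<Gamma> p \<inter> P_positions \<Gamma> \<noteq> {}"
  by (rule N_positions.simps[of p \<Gamma>, THEN trans]) (simp add: disjoint_iff)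

lemma P_N_partition:
  fixes \<Gamma> :: "(int ^ 'd::finite) set"
  assumes "rule_set \<Gamma>"
  shows "P_positions \<Gamma> \<union> N_positions \<Gamma> = board" "P_positions \<Gamma> \<inter> N_positions \<Gamma> = {}"
proof -
  obtain m :: "int ^ 'd \<Rightarrow> nat"
    where m: "\<And>p q. p \<in> board \<Longrightarrow> q \<in> game_opts \<Gamma> p \<Longrightarrow> m q < m p"
    using rule_set_measure[OF assms] by auto
  have *: "p \<in> board \<Longrightarrow> p \<in> P_positions \<Gamma> \<longleftrightarrow> p \<notin> N_positions \<Gamma>" for p
  proof (induction "m p" arbitrary: p rule: less_induct)
    case less
    have "q \<in> P_positions \<Gamma> \<longleftrightarrow> q \<notin> N_positions \<Gamma>" if "q \<in> game_opts \<Gamma> p" for q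
      by (rule less.hyps[OF m[OF less.prems that] game_opts_board[OF that]])
    then show ?case
      by (simp add: P_pos_iff[of p] N_pos_iff[of p] less.prems subset_iff disjoint_iff)
  qed
  have P: "p \<in> board" if "p \<in> P_positions \<Gamma>" for p
    using that by (rule P_pos_iff[THEN iffD1, THEN conjunct1])
  have N: "p \<in> board" if "p \<in> N_positions \<Gamma>" for p
    using that by (rule N_pos_iff[THEN iffD1, THEN conjunct1])
  show "P_positions \<Gamma> \<union> N_positions \<Gamma> = board"
    by (rule set_eqI) (metis * P N Un_iff)
  show "P_positions \<Gamma> \<inter> N_positions \<Gamma> = {}"
    by (metis * P disjoint_iff)
qed

lemma P_N_unique:
  fixes \<Gamma> :: "(int ^ 'd::finite) set"
  assumes "rule_set \<Gamma>" and "P \<union> N = board" "P \<inter> N = {}"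
    and rec_P: "\<And>p. p \<in> board \<Longrightarrow> p \<in> P \<longleftrightarrow> game_opts \<Gamma> p \<subseteq> N"
    and rec_N: "\<And>p. p \<in> board \<Longrightarrow> p \<in> N \<longleftrightarrow> game_opts \<Gamma> p \<inter> P \<noteq> {}"
  shows "P = P_positions \<Gamma>" "N = N_positions \<Gamma>"
proof -
  obtain m :: "int ^ 'd \<Rightarrow> nat"
    where m: "\<And>p q. p \<in> board \<Longrightarrow> q \<in> game_opts \<Gamma> p \<Longrightarrow> m q < m p"
    using rule_set_measure[OF assms(1)] by auto
  have *: "p \<in> board \<Longrightarrow> (p \<in> P \<longleftrightarrow> p \<in> P_positions \<Gamma>) \<and> (p \<in> N \<longleftrightarrow> p \<in> N_positions \<Gamma>)" for p
  proof (induction "m p" arbitrary: p rule: less_induct)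
    case less
    have "(q \<in> P \<longleftrightarrow> q \<in> P_positions \<Gamma>) \<and> (q \<in> N \<longleftrightarrow> q \<in> N_positions \<Gamma>)"
      if "q \<in> game_opts \<Gamma> p" for q
      by (rule less.hyps[OF m[OF less.prems that] game_opts_board[OF that]])
    then show ?case
      by (simp add: rec_P[OF less.prems] rec_N[OF less.prems] P_pos_iff[of p] N_pos_iff[of p]
          less.prems subset_iff disjoint_iff)
  qed
  show "P = P_positions \<Gamma>"
    by (rule set_eqI) (metis * Un_iff assms(2) P_N_partition(1)[OF assms(1)])
  show "N = N_positions \<Gamma>"
    by (rule set_eqI) (metis * Un_iff assms(2) P_N_partition(1)[OF assms(1)])
qed

end

theory Submission
  imports Defs
begin

text \<open>In a squarefree game a move needs at most one unit in one coordinate, so a move available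
  from a sum \<open>p + r\<close> is already available from \<open>p\<close> or from \<open>r\<close>. Hence \<open>p + r\<close> behaves as a
  disjunctive sum of games: adding a P-position never changes the outcome, by the usual
  argument of answering each move in the summand where it was made.\<close>

text \<open>A move from \<open>0\<close> by \<open>\<gamma>\<close> would put
  \<open>- \<gamma>\<close> on the board, making the linear form positive on both a vector and its
  negative. So \<open>0\<close> has no options.\<close>

lemma zero_in_P_positions:
  fixes \<Gamma> :: "(int ^ 'd::finite) set"
  assumes "rule_set \<Gamma>"
  shows "0 \<in> P_positions \<Gamma>"
proof -
  obtain l :: "real ^ 'd \<Rightarrow> real" where lin: "linear l"
    and pos: "\<forall>\<gamma>\<in>\<Gamma>. 0 < l (\<chi> i. real_of_int (\<gamma> $ i))"
    and nn: "\<forall>x. x \<noteq> 0 \<and> (\<forall>i. 0 \<le> x $ i) \<longrightarrow> 0 < l x"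
    using assms unfolding rule_set_def by (elim conjE exE)
  have "- \<gamma> \<notin> board" if "\<gamma> \<in> \<Gamma>" for \<gamma>
  proof
    assume neg: "- \<gamma> \<in> board"
    define x :: "real ^ 'd" where "x = (\<chi> i. real_of_int (\<gamma> $ i))"
    have "0 < l x"
      using bspec[OF pos that] by (simp add: x_def)
    moreover from this have "- x \<noteq> 0"
      using linear_0[OF lin] by (cases "x = 0") simp_all
    then have "0 < l (- x)"
      using neg by (intro nn[rule_format]) (auto simp: x_def board_def)
    ultimately show False
      by (simp add: linear_neg[OF lin])
  qed
  then have "game_opts \<Gamma> 0 = {}"
    by (auto simp: game_opts_def)
  then show ?thesis
    by (simp add: P_pos_iff board_def)
qed

lemma board_add: "p \<in> board \<Longrightarrow> r \<in> board \<Longrightarrow> p + r \<in> board"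
  by (simp add: board_def)

lemma game_opts_add_right:
  assumes "p \<in> board" and "r' \<in> game_opts \<Gamma> r"
  shows "p + r' \<in> game_opts \<Gamma> (p + r)"
proof -
  obtain \<gamma> where g: "\<gamma> \<in> \<Gamma>" and r': "r' = r - \<gamma>" "r' \<in> board"
    using assms(2) by (auto simp: game_opts_def)
  have "p + r' \<in> board"
    using assms(1) r'(2) by (rule board_add)
  moreover have "p + r' = (p + r) - \<gamma>"
    using r'(1) by simp
  ultimately have "p + r' = (p + r) - \<gamma> \<and> \<gamma> \<in> \<Gamma> \<and> (p + r) - \<gamma> \<in> board"
    using g by simp
  then show ?thesis
    unfolding game_opts_def by blast
qed

lemma squarefree_game_opts_add_cases:
  fixes \<Gamma> :: "(int ^ 'd::finite) set"
  assumes "squarefree_game \<Gamma>" and p: "p \<in> board" and r: "r \<in> board"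
    and "q \<in> game_opts \<Gamma> (p + r)"
  obtains (left) p' where "p' \<in> game_opts \<Gamma> p" "q = p' + r"
  | (right) r' where "r' \<in> game_opts \<Gamma> r" "q = p + r'"
proof -
  obtain \<gamma> where g: "\<gamma> \<in> \<Gamma>" and q: "q = p + r - \<gamma>" "q \<in> board"
    using assms(4) by (auto simp: game_opts_def)
  have card: "card {i. 0 < \<gamma> $ i} \<le> 1" and "\<forall>i. 0 < \<gamma> $ i \<longrightarrow> \<gamma> $ i \<le> 1"
    using assms(1) g by (simp_all add: squarefree_game_def)
  then have le1: "\<gamma> $ i \<le> 1" for i
    by (cases "0 < \<gamma> $ i") simp_all
  have single: "i = j" if "0 < \<gamma> $ i" "0 < \<gamma> $ j" for i j
    using card that by (auto simp: card_le_Suc0_iff_eq)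
  have "p - \<gamma> \<in> board \<or> r - \<gamma> \<in> board"
  proof (rule ccontr)
    assume "\<not> ?thesis"
    \<comment> \<open>Both shortfalls occur at positive entries of \<open>\<gamma>\<close>, hence at
      one coordinate \<open>i\<close>. There the two strict inequalities give
      \<open>p $ i + r $ i \<le> 2 * \<gamma> $ i - 2\<close>, while legality of the move from
      \<open>p + r\<close> gives \<open>\<gamma> $ i \<le> p $ i + r $ i\<close>; together they
      force \<open>\<gamma> $ i \<ge> 2\<close>.\<close>
    then obtain i j where i: "p $ i < \<gamma> $ i" and j: "r $ j < \<gamma> $ j"
      by (auto simp: board_def not_le)
    have "0 \<le> p $ i" "0 \<le> r $ j"
      using p r by (auto simp: board_def)
    with i j have "j = i"
      by (intro single) linarith+
    moreover have "\<gamma> $ i \<le> p $ i + r $ i"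
      using q by (auto simp: board_def)
    ultimately show False
      using i j le1[of i] by simp
  qed
  then show thesis
  proof
    assume "p - \<gamma> \<in> board"
    then show thesis
      using g q by (intro left[of "p - \<gamma>"]) (auto simp: game_opts_def)
  next
    assume "r - \<gamma> \<in> board"
    then show thesis
      using g q by (intro right[of "r - \<gamma>"]) (auto simp: game_opts_def)
  qed
qed

text \<open>The induction needs an equivalence, not just closure of P-positions under addition: when
  a move leads to an N-position \<open>r'\<close>, it must also exclude \<open>p + r'\<close> from
  the P-positions.\<close>

lemma add_P_position_iff:
  fixes \<Gamma> :: "(int ^ 'd::finite) set"
  assumes rs: "rule_set \<Gamma>" and sf: "squarefree_game \<Gamma>"
    and "p \<in> P_positions \<Gamma>" and "r \<in> board"
  shows "p + r \<in> P_positions \<Gamma> \<longleftrightarrow> r \<in> P_positions \<Gamma>"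
proof -
  obtain m :: "int ^ 'd \<Rightarrow> nat"
    where m: "\<And>p q. p \<in> board \<Longrightarrow> q \<in> game_opts \<Gamma> p \<Longrightarrow> m q < m p"
    using rule_set_measure[OF rs] by auto
  have notP: "q \<notin> P_positions \<Gamma> \<longleftrightarrow> q \<in> N_positions \<Gamma>" if "q \<in> board" for q
    using P_N_partition[OF rs] that by blast
  show ?thesis
    using assms(3,4)
  \<comment> \<open>The measure is taken on the sum, so a move in either summand decreases it, and
    the summands may exchange roles.\<close>
  proof (induction "m (p + r)" arbitrary: p r rule: less_induct)
    case less
    have p: "p \<in> board"
      using less.prems(1) by (simp add: P_pos_iff)
    have pr: "p + r \<in> board"
      using p less.prems(2) by (rule board_add)
    show ?case
    proof
      assume r: "r \<in> P_positions \<Gamma>"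
      have "q \<in> N_positions \<Gamma>" if q: "q \<in> game_opts \<Gamma> (p + r)" for q
        using sf p less.prems(2) q
      proof (cases rule: squarefree_game_opts_add_cases)
        case (left p')
        have p': "p' \<in> board" "p' \<notin> P_positions \<Gamma>"
          using game_opts_board[OF left(1)] notP[of p'] left(1)
            less.prems(1)[unfolded P_pos_iff[of p]] by blast+
        \<comment> \<open>After the move in \<open>p\<close>, the P-position is \<open>r\<close> and
          the added position is \<open>p'\<close>: the hypothesis is used with the summands
          swapped.\<close>
        have "m (r + p') < m (p + r)"
          using m[OF pr q] left(2) by (simp add: add.commute)
        then have "r + p' \<notin> P_positions \<Gamma>"
          using less.hyps[OF _ r p'(1)] p'(2) by blast
        then show ?thesis
          using left(2) notP[OF game_opts_board[OF q]] by (simp add: add.commute)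
      next
        case (right r')
        have r': "r' \<in> board" "r' \<notin> P_positions \<Gamma>"
          using game_opts_board[OF right(1)] notP[of r'] right(1)
            r[unfolded P_pos_iff[of r]] by blast+
        have "p + r' \<notin> P_positions \<Gamma>"
          using less.hyps[OF _ less.prems(1) r'(1)] m[OF pr q] right(2) r'(2) by blast
        then show ?thesis
          using right(2) notP[OF game_opts_board[OF q]] by simp
      qed
      then show "p + r \<in> P_positions \<Gamma>"
        using pr by (intro P_posI)
    next
      assume prP: "p + r \<in> P_positions \<Gamma>"
      show "r \<in> P_positions \<Gamma>"
      proof (rule ccontr)
        assume "r \<notin> P_positions \<Gamma>"
        \<comment> \<open>A winning move in \<open>r\<close> would remain a winning move in
          \<open>p + r\<close>.\<close>
        then obtain r' where r': "r' \<in> game_opts \<Gamma> r" "r' \<in> P_positions \<Gamma>"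
          using notP[OF less.prems(2)] N_pos_iff[of r \<Gamma>] by blast
        have opt: "p + r' \<in> game_opts \<Gamma> (p + r)"
          using p r'(1) by (rule game_opts_add_right)
        have "p + r' \<in> P_positions \<Gamma>"
          using less.hyps[OF m[OF pr opt] less.prems(1) game_opts_board[OF r'(1)]] r'(2) by blast
        then have "p + r \<in> N_positions \<Gamma>"
          using pr opt by (intro N_posI)
        then show False
          using prP notP[OF pr] by blast
      qed
    qed
  qed
qed

theorem proposition2:
  fixes \<Gamma> :: "(int ^ 'd::finite) set" and p :: "int ^ 'd"
  assumes "rule_set \<Gamma>" and "squarefree_game \<Gamma>" and "p \<in> board"
  shows "p \<in> P_positions \<Gamma> \<longleftrightarrow> indist \<Gamma> p 0"
proof
  assume "p \<in> P_positions \<Gamma>"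
  then show "indist \<Gamma> p 0"
    using add_P_position_iff[OF assms(1,2)] by (simp add: indist_def)
next
  assume "indist \<Gamma> p 0"
  moreover have "0 \<in> (board :: (int ^ 'd) set)"
    by (simp add: board_def)
  \<comment> \<open>Testing indistinguishability at \<open>r = 0\<close> compares the outcome of
    \<open>p\<close> with that of the P-position \<open>0\<close>.\<close>
  ultimately have "p + 0 \<in> P_positions \<Gamma> \<longleftrightarrow> 0 + 0 \<in> P_positions \<Gamma>"
    unfolding indist_def by blast
  then show "p \<in> P_positions \<Gamma>"
    using zero_in_P_positions[OF assms(1)] by simp
qed

end
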